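(* Let $K$ be a field and let $I\subset S=K[x_1,x_2,x_3]$ be a monomial ideal with $g(I)=3$ and $c(I)=3$. Then $\operatorname{sdepth}(I)=2$.
   Context: For a monomial ideal $I$: $G(I)$ is the set of minimal monomial generators of $I$; $g(I)=|G(I)|$; $v=\gcd(u\mid u\in G(I))$; $I'=(I:v)$, so $I=vI'$; $\operatorname{supp}(I)$ is the set of variables dividing some element of $G(I)$; $c(I)=|\operatorname{supp}(I')|$. A Stanley decomposition of a nonzero monomial ideal $I\subset S$ is a decomposition $\mathcal D:\ I=\bigoplus_{i=1}^r u_iK[Z_i]$ as a $K$-vector space, where $u_i\in S$ are monomials and $Z_i$ are subsets of the set of variables of $S$; $u_iK[Z_i]$ is the $K$-span of the monomials $u_iw$ with $w$ a monomial in the variables of $Z_i$. Put $\operatorname{sdepth}(\mathcal D)=\min_i|Z_i|$, and let $\operatorname{sdepth}(I)$ be the maximum of $\operatorname{sdepth}(\mathcal D)$ over all Stanley decompositions of $I$. *)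

theory Defs
  imports Complex_Main "HOL-Library.Poly_Mapping" "HOL-Library.Numeral_Type"
begin

text \<open>
  Polynomials over \<open>'k\<close> in variables indexed by \<open>'x\<close>: finitely supported maps from exponent
  vectors to coefficients, with the convolution product of \<open>Poly_Mapping\<close>. For \<open>'x = 3\<close> (the type
  with exactly three elements) this is the polynomial ring in three variables.
\<close>

type_synonym ('x, 'k) mpoly = "('x \<Rightarrow>\<^sub>0 nat) \<Rightarrow>\<^sub>0 'k"

definition Var :: "'x \<Rightarrow> ('x, 'k::field) mpoly"
  where "Var i = Poly_Mapping.single (Poly_Mapping.single i 1) 1"

definition monomials :: "('x, 'k::field) mpoly set"
  where "monomials = range (\<lambda>t. Poly_Mapping.single t 1)"

definition monomials_in :: "'x set \<Rightarrow> ('x, 'k::field) mpoly set"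
  where "monomials_in Z = {Poly_Mapping.single t 1 | t. Poly_Mapping.keys t \<subseteq> Z}"

text \<open>The ring as a module over itself: its submodules are the ideals.\<close>

global_interpretation ideal: module "(*) :: 'a \<Rightarrow> 'a \<Rightarrow> 'a::comm_ring_1"
  by unfold_locales (simp_all add: algebra_simps)

text \<open>The ring as a \<open>'k\<close>-vector space: \<open>single 0 c\<close> is the constant polynomial \<open>c\<close>.\<close>

definition scale :: "'k \<Rightarrow> ('x, 'k::field) mpoly \<Rightarrow> ('x, 'k) mpoly"
  where "scale c p = Poly_Mapping.single 0 c * p"

global_interpretation mpoly: vector_space "scale :: 'k::field \<Rightarrow> ('x, 'k) mpoly \<Rightarrow> ('x, 'k) mpoly"
proof unfold_locales
  show "scale a (x + y) = scale a x + scale a y" for a :: 'k and x y :: "('x, 'k) mpoly"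
    by (simp only: scale_def distrib_left)
  show "scale (a + b) x = scale a x + scale b x" for a b :: 'k and x :: "('x, 'k) mpoly"
    by (simp only: scale_def single_add distrib_right)
  show "scale a (scale b x) = scale (a * b) x" for a b :: 'k and x :: "('x, 'k) mpoly"
    by (simp add: scale_def mult_single flip: mult.assoc)
  show "scale 1 x = x" for x :: "('x, 'k) mpoly"
    by (simp add: scale_def)
qed

definition monomial_ideal :: "('x, 'k::field) mpoly set \<Rightarrow> bool"
  where "monomial_ideal I \<longleftrightarrow> (\<exists>M \<subseteq> monomials. I = ideal.span M)"

definition min_gens :: "('x, 'k::field) mpoly set \<Rightarrow> ('x, 'k) mpoly set"
  where "min_gens I = (THE G. G \<subseteq> monomials \<and> ideal.span G = I \<and> (\<forall>H. H \<subset> G \<longrightarrow> ideal.span H \<noteq> I))"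

definition num_gens :: "('x, 'k::field) mpoly set \<Rightarrow> nat"
  where "num_gens I = card (min_gens I)"

text \<open>Greatest common divisors are unique only up to units; the one meant is the monomial.\<close>

definition gens_gcd :: "('x, 'k::field) mpoly set \<Rightarrow> ('x, 'k) mpoly"
  where "gens_gcd I = (THE v. v \<in> monomials \<and> (\<forall>u\<in>min_gens I. v dvd u) \<and>
                              (\<forall>w. (\<forall>u\<in>min_gens I. w dvd u) \<longrightarrow> w dvd v))"

definition ideal_colon :: "'a::comm_ring_1 set \<Rightarrow> 'a \<Rightarrow> 'a set"
  where "ideal_colon I v = {f. f * v \<in> I}"

definition reduced_ideal :: "('x, 'k::field) mpoly set \<Rightarrow> ('x, 'k) mpoly set"
  where "reduced_ideal I = ideal_colon I (gens_gcd I)"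

definition ideal_supp :: "('x, 'k::field) mpoly set \<Rightarrow> 'x set"
  where "ideal_supp I = {i. \<exists>u\<in>min_gens I. Var i dvd u}"

definition num_supp_reduced :: "('x, 'k::field) mpoly set \<Rightarrow> nat"
  where "num_supp_reduced I = card (ideal_supp (reduced_ideal I))"

text \<open>Stanley decompositions. A pair \<open>(u, Z)\<close> stands for the space \<open>u K[Z]\<close>.\<close>

definition stanley_space :: "('x, 'k::field) mpoly \<times> 'x set \<Rightarrow> ('x, 'k) mpoly set"
  where "stanley_space = (\<lambda>(u, Z). mpoly.span {u * w | w. w \<in> monomials_in Z})"

definition direct_sum_decomp :: "'i set \<Rightarrow> ('i \<Rightarrow> 'a::ab_group_add set) \<Rightarrow> 'a set \<Rightarrow> bool"
  where "direct_sum_decomp A V W \<longleftrightarrow>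
    W = {\<Sum>i\<in>A. f i | f. \<forall>i\<in>A. f i \<in> V i} \<and>
    (\<forall>f. (\<forall>i\<in>A. f i \<in> V i) \<and> (\<Sum>i\<in>A. f i) = 0 \<longrightarrow> (\<forall>i\<in>A. f i = 0))"

definition stanley_decomp ::
    "('x, 'k::field) mpoly set \<Rightarrow> (('x, 'k) mpoly \<times> 'x set) list \<Rightarrow> bool"
  where "stanley_decomp I D \<longleftrightarrow>
    (\<forall>(u, Z) \<in> set D. u \<in> monomials) \<and>
    direct_sum_decomp {..<length D} (\<lambda>i. stanley_space (D ! i)) I"

definition decomp_sdepth :: "(('x, 'k::field) mpoly \<times> 'x set) list \<Rightarrow> nat"
  where "decomp_sdepth D = Min ((\<lambda>(u, Z). card Z) ` set D)"

text \<open>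
  The depths are bounded by the number of variables, so for finite \<open>'x\<close> the maximum is over a
  finite set. Only meant for \<open>I \<noteq> {0}\<close>.
\<close>

definition sdepth :: "('x::finite, 'k::field) mpoly set \<Rightarrow> nat"
  where "sdepth I = Max {decomp_sdepth D | D. stanley_decomp I D}"

end

theory Submission
  imports Defs "HOL-Library.Disjoint_Sets"
begin

text \<open>
  For any three sets, the differences \<open>A - B\<close>, \<open>B - C\<close>, \<open>C - A\<close> and the intersection
  \<open>A \<inter> B \<inter> C\<close> partition \<open>A \<union> B \<union> C\<close>. Apply this to the exponent sets of the three principal
  ideals generated by the minimal generators: the intersection is the exponent set of a principal
  ideal, and a difference of two such sets is cut by hyperplanes \<open>e\<^sub>i = const\<close> into
  finitely many translated orthants of codimension one. So the Stanley depth is at least \<open>n - 1\<close>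
  in \<open>n\<close> variables. It is not \<open>n\<close>, because any two nonzero ideals \<open>u S\<close> and \<open>v S\<close> share the
  element \<open>u v\<close>, so that only a principal ideal can have Stanley depth \<open>n\<close>.
\<close>

section \<open>Partitions of exponent sets\<close>

abbreviation (input) lookup :: "('a \<Rightarrow>\<^sub>0 'b::zero) \<Rightarrow> 'a \<Rightarrow> 'b"
  where "lookup \<equiv> Poly_Mapping.lookup"

abbreviation (input) keys :: "('a \<Rightarrow>\<^sub>0 'b::zero) \<Rightarrow> 'a set"
  where "keys \<equiv> Poly_Mapping.keys"

text \<open>These are the exponents of the monomials in \<open>u K[Z]\<close>, where
  \<open>u\<close> has exponent \<open>a\<close>. The coordinatewise form reduces inclusions and
  disjointness to comparing numbers.\<close>

definition cone :: "('x \<Rightarrow>\<^sub>0 nat) \<Rightarrow> 'x set \<Rightarrow> ('x \<Rightarrow>\<^sub>0 nat) set"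
  where "cone a Z = {t. \<forall>i. lookup a i \<le> lookup t i \<and> (i \<notin> Z \<longrightarrow> lookup t i = lookup a i)}"

text \<open>Membership of \<open>t\<close> expresses that the monomial with exponent
  \<open>a\<close> divides the one with exponent \<open>t\<close>.\<close>

abbreviation upset :: "('x \<Rightarrow>\<^sub>0 nat) \<Rightarrow> ('x \<Rightarrow>\<^sub>0 nat) set"
  where "upset a \<equiv> cone a UNIV"

lemma apex_in_cone [simp]: "a \<in> cone a Z"
  by (simp add: cone_def)

lemma cone_subset_upset: "cone a Z \<subseteq> upset a"
  by (auto simp: cone_def)

lemma upset_iff: "t \<in> upset a \<longleftrightarrow> (\<forall>i. lookup a i \<le> lookup t i)"
  by (simp add: cone_def)

lemma upset_trans: "b \<in> upset a \<Longrightarrow> t \<in> upset b \<Longrightarrow> t \<in> upset a"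
  by (auto simp: upset_iff intro: order_trans)

lemma upset_antisym: "b \<in> upset a \<Longrightarrow> a \<in> upset b \<Longrightarrow> a = b"
  by (auto simp: upset_iff intro!: poly_mapping_eqI order_antisym)

lemma add_in_upset [simp]: "a + t \<in> upset a" "t + a \<in> upset a"
  by (simp_all add: upset_iff lookup_add)

text \<open>Subtraction of exponents is truncated in each coordinate; divisibility makes it
  exact.\<close>

lemma upset_add_diff: "t \<in> upset a \<Longrightarrow> a + (t - a) = t"
  by (intro poly_mapping_eqI) (auto simp: upset_iff lookup_add lookup_minus)

lemma cone_eq_translate: "cone a Z = {a + t | t. keys t \<subseteq> Z}"
proof (intro equalityI subsetI)
  fix t assume t: "t \<in> cone a Z"
  then have "a + (t - a) = t"
    using cone_subset_upset upset_add_diff by blast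
  moreover have "keys (t - a) \<subseteq> Z"
    using t by (auto simp: cone_def in_keys_iff lookup_minus)
  ultimately show "t \<in> {a + t | t. keys t \<subseteq> Z}"
    by (metis (mono_tags, lifting) mem_Collect_eq)
next
  fix t assume "t \<in> {a + t | t. keys t \<subseteq> Z}"
  then show "t \<in> cone a Z"
    by (auto simp: cone_def lookup_add in_keys_iff)
qed

definition cone_partition :: "(('x \<Rightarrow>\<^sub>0 nat) \<times> 'x set) set \<Rightarrow> ('x \<Rightarrow>\<^sub>0 nat) set \<Rightarrow> bool"
  where "cone_partition P E \<longleftrightarrow> finite P \<and> disjoint_family_on (\<lambda>(a, Z). cone a Z) P \<and>
    (\<Union>(a, Z)\<in>P. cone a Z) = E"

definition partitionable :: "nat \<Rightarrow> ('x \<Rightarrow>\<^sub>0 nat) set \<Rightarrow> bool"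
  where "partitionable m E \<longleftrightarrow> (\<exists>P. cone_partition P E \<and> (\<forall>(a, Z)\<in>P. m \<le> card Z))"

lemma partitionable_empty: "partitionable m {}"
  unfolding partitionable_def cone_partition_def
  by (rule exI[of _ "{}"]) (simp add: disjoint_family_on_def)

lemma partitionable_cone: "m \<le> card Z \<Longrightarrow> partitionable m (cone a Z)"
  unfolding partitionable_def cone_partition_def
  by (rule exI[of _ "{(a, Z)}"]) (simp add: disjoint_family_on_def)

lemma partitionable_Un:
  assumes "partitionable m E" "partitionable m F" "E \<inter> F = {}"
  shows "partitionable m (E \<union> F)"
proof -
  obtain P Q where P: "cone_partition P E" "\<forall>(a, Z)\<in>P. m \<le> card Z"
    and Q: "cone_partition Q F" "\<forall>(a, Z)\<in>Q. m \<le> card Z"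
    using assms unfolding partitionable_def by blast
  let ?C = "\<lambda>(a, Z). cone a Z"
  have sub: "\<And>p. p \<in> P \<Longrightarrow> ?C p \<subseteq> E" "\<And>q. q \<in> Q \<Longrightarrow> ?C q \<subseteq> F"
    using P(1) Q(1) unfolding cone_partition_def by blast+
  have "?C p \<inter> ?C q = {}" if pq: "p \<in> P \<union> Q" "q \<in> P \<union> Q" "p \<noteq> q" for p q
  proof -
    consider "p \<in> P" "q \<in> P" | "p \<in> Q" "q \<in> Q" | "p \<in> P" "q \<in> Q" | "p \<in> Q" "q \<in> P"
      using pq by blast
    then show ?thesis
    proof cases
      case 1 then show ?thesis
        using P(1) pq(3) unfolding cone_partition_def disjoint_family_on_def by blast
    next
      case 2 then show ?thesis
        using Q(1) pq(3) unfolding cone_partition_def disjoint_family_on_def by blast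
    next
      case 3 then show ?thesis using sub(1)[of p] sub(2)[of q] assms(3) by blast
    next
      case 4 then show ?thesis using sub(1)[of q] sub(2)[of p] assms(3) by blast
    qed
  qed
  then have "disjoint_family_on ?C (P \<union> Q)"
    unfolding disjoint_family_on_def by blast
  then have "cone_partition (P \<union> Q) (E \<union> F)"
    using P(1) Q(1) unfolding cone_partition_def by auto
  then show ?thesis
    unfolding partitionable_def using P(2) Q(2) by (intro exI[of _ "P \<union> Q"]) (simp add: ball_Un)
qed

text \<open>Raising the bound from \<open>k\<close> to \<open>Suc k\<close> adds the section at
  height \<open>k\<close> in direction \<open>i\<close>. If it meets the orthant, it is a single
  cone in which every direction except \<open>i\<close> is free.\<close>

lemma partitionable_slab:
  fixes a :: "'x::finite \<Rightarrow>\<^sub>0 nat"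
  shows "partitionable (CARD('x) - 1) {t \<in> upset a. lookup t i < k}"
proof (induction k)
  case 0
  then show ?case by (simp add: partitionable_empty)
next
  case (Suc k)
  show ?case
  proof (cases "lookup a i \<le> k")
    case True
    have "{t \<in> upset a. lookup t i < Suc k} =
        {t \<in> upset a. lookup t i < k} \<union> cone (Poly_Mapping.update i k a) (- {i})"
      using True by (auto simp: cone_def lookup_update split: if_splits)
    moreover have "partitionable (CARD('x) - 1) (cone (Poly_Mapping.update i k a) (- {i}))"
      by (intro partitionable_cone) (simp add: Compl_eq_Diff_UNIV)
    moreover have "{t \<in> upset a. lookup t i < k} \<inter> cone (Poly_Mapping.update i k a) (- {i}) = {}"
      by (auto simp: cone_def lookup_update)
    ultimately show ?thesis
      using partitionable_Un[OF Suc.IH] by simp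
  next
    case False
    then have "{t \<in> upset a. lookup t i < Suc k} = {}"
      by (auto simp: upset_iff not_le) (metis less_Suc_eq_le order_trans not_le)
    then show ?thesis by (simp only: partitionable_empty)
  qed
qed

text \<open>The points below \<open>b\<close> at \<open>i\<close> form a slab. For the others the
  bound at \<open>i\<close> is absorbed into a raised apex, leaving a set of the same form for
  \<open>F\<close>; hence the induction leaves \<open>a\<close> arbitrary.\<close>

lemma partitionable_below_some:
  fixes a b :: "'x::finite \<Rightarrow>\<^sub>0 nat"
  assumes "finite F"
  shows "partitionable (CARD('x) - 1) {t \<in> upset a. \<exists>i\<in>F. lookup t i < lookup b i}"
  using assms
proof (induction F arbitrary: a)
  case empty
  then show ?case by (simp add: partitionable_empty)
next
  case (insert i F)
  define a' where "a' = Poly_Mapping.update i (max (lookup a i) (lookup b i)) a"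
  have a': "t \<in> upset a' \<longleftrightarrow> t \<in> upset a \<and> lookup b i \<le> lookup t i" for t
    unfolding a'_def upset_iff by (auto simp: lookup_update)
  have "{t \<in> upset a. \<exists>j\<in>insert i F. lookup t j < lookup b j} =
      {t \<in> upset a. lookup t i < lookup b i} \<union> {t \<in> upset a'. \<exists>j\<in>F. lookup t j < lookup b j}"
    by (auto simp: a')
  moreover have "{t \<in> upset a. lookup t i < lookup b i} \<inter>
      {t \<in> upset a'. \<exists>j\<in>F. lookup t j < lookup b j} = {}"
    by (auto simp: a')
  ultimately show ?case
    using partitionable_Un[OF partitionable_slab insert.IH] by simp
qed

lemma partitionable_diff:
  fixes a b :: "'x::finite \<Rightarrow>\<^sub>0 nat"
  shows "partitionable (CARD('x) - 1) (upset a - upset b)"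
proof -
  have "upset a - upset b = {t \<in> upset a. \<exists>i\<in>UNIV. lookup t i < lookup b i}"
    by (auto simp: upset_iff simp flip: not_le)
  then show ?thesis by (simp only: partitionable_below_some finite)
qed

lemma upset_Int: "\<exists>c. upset a \<inter> upset b = upset c"
proof -
  \<comment> \<open>With truncated subtraction this sum is the coordinatewise maximum, the exponent
    of the least common multiple.\<close>
  have "lookup (a + (b - a)) i = max (lookup a i) (lookup b i)" for i
    by (simp add: lookup_add lookup_minus)
  then have "upset a \<inter> upset b = upset (a + (b - a))"
    by (auto simp: upset_iff)
  then show ?thesis by blast
qed

lemma partitionable_three:
  fixes a b c :: "'x::finite \<Rightarrow>\<^sub>0 nat"
  shows "partitionable (CARD('x) - 1) (upset a \<union> upset b \<union> upset c)"
proof -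
  let ?A = "upset a" and ?B = "upset b" and ?C = "upset c"
  obtain d where d: "?A \<inter> ?B \<inter> ?C = upset d"
    by (metis upset_Int)
  have "partitionable (CARD('x) - 1) (upset d)"
    by (intro partitionable_cone) simp
  \<comment> \<open>A point in some but not all of the sets, read around the cycle A, B, C, passes
    from membership to non-membership exactly once. So it lies in exactly one of the three
    differences.\<close>
  moreover have "?A \<union> ?B \<union> ?C = (?A - ?B) \<union> ((?B - ?C) \<union> ((?C - ?A) \<union> (?A \<inter> ?B \<inter> ?C)))"
    by blast
  ultimately show ?thesis
    using partitionable_diff[of a b] partitionable_diff[of b c] partitionable_diff[of c a]
    by (auto simp only: d[symmetric] intro!: partitionable_Un)
qed

section \<open>Monomial subspaces\<close>

text \<open>Monomial ideals and Stanley spaces both have this form, so statements about them become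
  statements about sets of exponents.\<close>

definition polys_on :: "('x \<Rightarrow>\<^sub>0 nat) set \<Rightarrow> ('x, 'k::field) mpoly set"
  where "polys_on E = {p. keys p \<subseteq> E}"

lemma polys_on_0 [simp]: "0 \<in> polys_on E"
  by (simp add: polys_on_def)

lemma polys_onD: "p \<in> polys_on E \<Longrightarrow> t \<in> keys p \<Longrightarrow> t \<in> E"
  unfolding polys_on_def by blast

lemma polys_on_lookup: "p \<in> polys_on E \<Longrightarrow> t \<notin> E \<Longrightarrow> lookup p t = 0"
  unfolding polys_on_def by (auto simp: in_keys_iff)

lemma polys_on_add: "p \<in> polys_on E \<Longrightarrow> q \<in> polys_on E \<Longrightarrow> p + q \<in> polys_on E"
  unfolding polys_on_def using keys_add[of p q] by blast

lemma single_1_in_polys_on_iff [simp]: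
  "Poly_Mapping.single t (1::'k::field) \<in> polys_on E \<longleftrightarrow> t \<in> E"
  by (simp add: polys_on_def)

lemma polys_on_eq_iff: "polys_on E = (polys_on F :: ('x, 'k::field) mpoly set) \<longleftrightarrow> E = F"
  using single_1_in_polys_on_iff[where 'k = 'k] by blast

text \<open>Projection onto \<open>polys_on E\<close> that drops all other terms; it supplies the
  components of a polynomial in a decomposition. Intersecting with \<open>keys p\<close> keeps the
  sum finite when \<open>E\<close> is infinite.\<close>

definition restrict_poly :: "('x \<Rightarrow>\<^sub>0 nat) set \<Rightarrow> ('x, 'k::field) mpoly \<Rightarrow> ('x, 'k) mpoly"
  where "restrict_poly E p = (\<Sum>t\<in>keys p \<inter> E. Poly_Mapping.single t (lookup p t))"

lemma lookup_restrict_poly: "lookup (restrict_poly E p) t = (if t \<in> E then lookup p t else 0)"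
  unfolding restrict_poly_def lookup_sum
  by (auto simp: lookup_single when_def sum.delta in_keys_iff)

lemma restrict_poly_in_polys_on: "restrict_poly E p \<in> polys_on E"
  by (auto simp: polys_on_def in_keys_iff lookup_restrict_poly split: if_splits)

lemma poly_eq_sum_singles: "(\<Sum>t\<in>keys p. Poly_Mapping.single t (lookup p t)) = (p :: ('x, 'k::field) mpoly)"
proof -
  have "restrict_poly UNIV p = p"
    by (rule poly_mapping_eqI) (simp add: lookup_restrict_poly)
  then show ?thesis by (simp add: restrict_poly_def)
qed

lemma keys_scale: "keys (scale c p) \<subseteq> keys p"
  unfolding scale_def using keys_mult[of "Poly_Mapping.single 0 c" p] by (auto split: if_splits)

lemma polys_on_scale: "p \<in> polys_on E \<Longrightarrow> scale c p \<in> polys_on E"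
  unfolding polys_on_def using keys_scale[of c p] by simp

lemma scale_single: "scale c (Poly_Mapping.single t 1) = Poly_Mapping.single t c"
  by (simp add: scale_def mult_single)

lemma span_singles:
  "mpoly.span ((\<lambda>t. Poly_Mapping.single t 1) ` E) = (polys_on E :: ('x, 'k::field) mpoly set)"
proof (intro equalityI)
  show "mpoly.span ((\<lambda>t. Poly_Mapping.single t 1) ` E) \<subseteq> (polys_on E :: ('x, 'k) mpoly set)"
  proof (rule mpoly.span_minimal)
    show "mpoly.subspace (polys_on E :: ('x, 'k) mpoly set)"
      by (simp add: mpoly.subspace_def polys_on_add polys_on_scale)
  qed auto
  show "(polys_on E :: ('x, 'k) mpoly set) \<subseteq> mpoly.span ((\<lambda>t. Poly_Mapping.single t 1) ` E)"
  proof
    fix p :: "('x, 'k) mpoly" assume "p \<in> polys_on E"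
    then have E: "keys p \<subseteq> E" by (simp add: polys_on_def)
    have "(\<Sum>t\<in>keys p. Poly_Mapping.single t (lookup p t))
        \<in> mpoly.span ((\<lambda>t. Poly_Mapping.single t 1) ` E)"
    proof (rule mpoly.span_sum)
      fix t assume "t \<in> keys p"
      then have "scale (lookup p t) (Poly_Mapping.single t 1)
          \<in> mpoly.span ((\<lambda>t. Poly_Mapping.single t 1) ` E)"
        using E by (intro mpoly.span_scale mpoly.span_base) blast
      then show "Poly_Mapping.single t (lookup p t)
          \<in> mpoly.span ((\<lambda>t. Poly_Mapping.single t 1) ` E)"
        by (simp only: scale_single)
    qed
    then show "p \<in> mpoly.span ((\<lambda>t. Poly_Mapping.single t 1) ` E)"
      by (simp only: poly_eq_sum_singles)
  qed
qed

lemma stanley_space_single: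
  "stanley_space (Poly_Mapping.single a 1, Z) = (polys_on (cone a Z) :: ('x, 'k::field) mpoly set)"
proof -
  have "{Poly_Mapping.single a 1 * w | w. w \<in> monomials_in Z} =
      ((\<lambda>t. Poly_Mapping.single t 1) ` cone a Z :: ('x, 'k) mpoly set)"
    unfolding monomials_in_def cone_eq_translate
    by (auto simp: mult_single image_iff) (metis mult_single mult_1)+
  then show ?thesis
    by (simp add: stanley_space_def span_singles)
qed

text \<open>Exponents of a product are sums of exponents of the factors, so the right-hand side
  absorbs multiplication. Conversely, each term of one of its elements is a multiple of a generator,
  with the coefficient put into the cofactor.\<close>

lemma ideal_span_singles:
  "ideal.span ((\<lambda>t. Poly_Mapping.single t 1) ` T) =
    (polys_on (\<Union>(upset ` T)) :: ('x, 'k::field) mpoly set)"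
proof (intro equalityI)
  let ?E = "\<Union>(upset ` T)"
  show "ideal.span ((\<lambda>t. Poly_Mapping.single t 1) ` T) \<subseteq> (polys_on ?E :: ('x, 'k) mpoly set)"
  proof (rule ideal.span_minimal)
    have "r * p \<in> polys_on ?E" if "p \<in> polys_on ?E" for r p :: "('x, 'k) mpoly"
    proof -
      have "s + t \<in> ?E" if t: "t \<in> keys p" for s t
      proof -
        obtain a where a: "a \<in> T" "t \<in> upset a"
          using polys_onD[OF \<open>p \<in> polys_on ?E\<close> t] by blast
        then have "s + t \<in> upset a"
          by (intro upset_trans[OF _ add_in_upset(2)])
        then show ?thesis
          using a(1) by (rule UN_I[rotated])
      qed
      then have "{s + t | s t. s \<in> keys r \<and> t \<in> keys p} \<subseteq> ?E"
        by auto
      then show ?thesis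
        unfolding polys_on_def using keys_mult[of r p] by simp
    qed
    then show "ideal.subspace (polys_on ?E :: ('x, 'k) mpoly set)"
      by (simp add: ideal.subspace_def polys_on_add)
    show "(\<lambda>t. Poly_Mapping.single t 1) ` T \<subseteq> (polys_on ?E :: ('x, 'k) mpoly set)"
    proof (rule image_subsetI)
      fix t assume "t \<in> T"
      then have "t \<in> ?E"
        by (rule UN_I) simp
      then show "Poly_Mapping.single t 1 \<in> (polys_on ?E :: ('x, 'k) mpoly set)"
        by (simp only: single_1_in_polys_on_iff)
    qed
  qed
  show "(polys_on ?E :: ('x, 'k) mpoly set) \<subseteq> ideal.span ((\<lambda>t. Poly_Mapping.single t 1) ` T)"
  proof
    fix p :: "('x, 'k) mpoly" assume p: "p \<in> polys_on ?E"
    have "(\<Sum>t\<in>keys p. Poly_Mapping.single t (lookup p t))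
        \<in> ideal.span ((\<lambda>t. Poly_Mapping.single t 1) ` T)"
    proof (rule ideal.span_sum)
      fix t assume "t \<in> keys p"
      with p have "t \<in> ?E"
        by (rule polys_onD)
      then obtain a where a: "a \<in> T" "t \<in> upset a"
        by blast
      have "Poly_Mapping.single (t - a) (lookup p t) * Poly_Mapping.single a 1
          \<in> ideal.span ((\<lambda>t. Poly_Mapping.single t 1) ` T)"
        using a(1) by (intro ideal.span_scale ideal.span_base) blast
      moreover have "t - a + a = t"
        using upset_add_diff[OF a(2)] by (simp add: add.commute)
      ultimately show "Poly_Mapping.single t (lookup p t)
          \<in> ideal.span ((\<lambda>t. Poly_Mapping.single t 1) ` T)"
        by (simp add: mult_single)
    qed
    then show "p \<in> ideal.span ((\<lambda>t. Poly_Mapping.single t 1) ` T)"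
      by (simp only: poly_eq_sum_singles)
  qed
qed

section \<open>Minimal generators\<close>

definition min_exps :: "('x \<Rightarrow>\<^sub>0 nat) set \<Rightarrow> ('x \<Rightarrow>\<^sub>0 nat) set"
  where "min_exps T = {t \<in> T. \<forall>s\<in>T. t \<in> upset s \<longrightarrow> s = t}"

text \<open>A proper divisor has smaller total degree, so descending through divisors within
  \<open>T\<close> ends at a minimal element, even for infinite \<open>T\<close>.\<close>

lemma Union_upset_min_exps:
  fixes T :: "('x::finite \<Rightarrow>\<^sub>0 nat) set"
  shows "\<Union>(upset ` min_exps T) = \<Union>(upset ` T)"
proof -
  define deg :: "('x \<Rightarrow>\<^sub>0 nat) \<Rightarrow> nat" where "deg t = (\<Sum>i\<in>UNIV. lookup t i)" for t
  have deg: "deg s < deg t" if st: "t \<in> upset s" "s \<noteq> t" for s t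
  proof -
    have le: "lookup s i \<le> lookup t i" for i
      using st(1) by (simp add: upset_iff)
    obtain i where "lookup s i \<noteq> lookup t i"
      using st(2) by (metis poly_mapping_eqI)
    then have "lookup s i < lookup t i"
      using le[of i] by simp
    then show ?thesis
      unfolding deg_def using le by (intro sum_strict_mono_ex1) auto
  qed
  have "\<exists>s\<in>min_exps T. t \<in> upset s" if "t \<in> T" for t
    using that
  proof (induction t rule: measure_induct_rule[of deg])
    case (less t)
    show ?case
    proof (cases "t \<in> min_exps T")
      case True
      then show ?thesis by (rule bexI[rotated]) simp
    next
      case False
      then obtain s where "s \<in> T" "t \<in> upset s" "s \<noteq> t"
        using less.prems by (auto simp: min_exps_def)
      then show ?thesis
        using less.IH deg upset_trans by blast
    qed
  qed
  then have "upset t \<subseteq> \<Union>(upset ` min_exps T)" if "t \<in> T" for t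
    using that upset_trans by (meson UN_I subsetI)
  moreover have "min_exps T \<subseteq> T"
    by (auto simp: min_exps_def)
  ultimately show ?thesis
    by (intro equalityI UN_mono UN_least) simp_all
qed

text \<open>The minimal monomials generate the ideal and lie in every monomial generating set. They
  therefore form the only irredundant one, which makes the definite description well
  defined.\<close>

lemma min_gens_ideal_span:
  fixes T :: "('x::finite \<Rightarrow>\<^sub>0 nat) set"
  shows "min_gens (ideal.span ((\<lambda>t. Poly_Mapping.single t 1) ` T) :: ('x, 'k::field) mpoly set) =
    (\<lambda>t. Poly_Mapping.single t 1) ` min_exps T"
proof -
  let ?m = "\<lambda>t. Poly_Mapping.single t 1 :: ('x, 'k) mpoly"
  let ?I = "ideal.span (?m ` T)"
  let ?P = "\<lambda>G. G \<subseteq> monomials \<and> ideal.span G = ?I \<and> (\<forall>H. H \<subset> G \<longrightarrow> ideal.span H \<noteq> ?I)"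
  have min_sub: "?m ` min_exps T \<subseteq> G" if G: "G \<subseteq> monomials" "ideal.span G = ?I" for G
  proof -
    obtain U where U: "G = ?m ` U"
      using G(1) unfolding monomials_def by (elim subset_imageE)
    have eq: "\<Union>(upset ` U) = \<Union>(upset ` T)"
      using G(2) by (simp only: U ideal_span_singles polys_on_eq_iff)
    \<comment> \<open>Some \<open>u\<close> in \<open>U\<close> divides \<open>t\<close>, and some
      \<open>s\<close> in \<open>T\<close> divides \<open>u\<close>. Minimality gives
      \<open>s = t\<close>, so \<open>t\<close> and \<open>u\<close> divide each other.\<close>
    have "t \<in> U" if t: "t \<in> min_exps T" for t
    proof -
      have "t \<in> T"
        using t by (simp add: min_exps_def)
      then have "t \<in> \<Union>(upset ` T)"
        by (rule UN_I) simp
      then obtain u where u: "u \<in> U" "t \<in> upset u"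
        unfolding eq[symmetric] by blast
      have "u \<in> \<Union>(upset ` U)"
        using u(1) by (rule UN_I) simp
      then obtain s where s: "s \<in> T" "u \<in> upset s"
        unfolding eq by blast
      have "s = t"
        using t s(1) upset_trans[OF s(2) u(2)] by (simp add: min_exps_def)
      then show ?thesis
        using upset_antisym s(2) u by metis
    qed
    then show ?thesis unfolding U by blast
  qed
  have gen: "ideal.span (?m ` min_exps T) = ?I"
    by (simp only: ideal_span_singles Union_upset_min_exps)
  have mon: "?m ` min_exps T \<subseteq> monomials"
    by (auto simp: monomials_def)
  have "(THE G. ?P G) = ?m ` min_exps T"
  proof (rule the_equality)
    show "?P (?m ` min_exps T)"
      using gen mon min_sub by (meson order_trans psubset_imp_subset psubsetE)
    show "G = ?m ` min_exps T" if "?P G" for G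
      using that gen min_sub by (metis psubsetI)
  qed
  then show ?thesis by (simp only: min_gens_def)
qed

lemma monomial_ideal_min_exps:
  fixes I :: "('x::finite, 'k::field) mpoly set"
  assumes "monomial_ideal I"
  obtains T where "I = polys_on (\<Union>(upset ` T))" "num_gens I = card T"
proof -
  obtain U where U: "I = ideal.span ((\<lambda>t. Poly_Mapping.single t 1) ` U)"
    using assms unfolding monomial_ideal_def monomials_def by (elim exE conjE subset_imageE) simp
  \<comment> \<open>The witness is \<open>min_exps U\<close> instead of \<open>U\<close>, because
    \<open>U\<close> may contain redundant generators and the cardinality must count the minimal
    ones.\<close>
  have "I = polys_on (\<Union>(upset ` min_exps U))"
    unfolding U ideal_span_singles Union_upset_min_exps ..
  moreover have "num_gens I = card (min_exps U)"
    unfolding num_gens_def U min_gens_ideal_span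
    by (intro card_image inj_onI) (metis keys_single singleton_inject zero_neq_one)
  ultimately show thesis by (rule that)
qed

text \<open>Used to exclude ideals of this form once the number of generators is known to differ
  from one.\<close>

lemma num_gens_principal:
  fixes a :: "'x::finite \<Rightarrow>\<^sub>0 nat"
  shows "num_gens (polys_on (upset a) :: ('x, 'k::field) mpoly set) = 1"
proof -
  have "min_exps {a} = {a}" by (auto simp: min_exps_def)
  then show ?thesis
    using min_gens_ideal_span[of "{a}", where 'k = 'k] ideal_span_singles[of "{a}", where 'k = 'k]
    by (simp add: num_gens_def)
qed

section \<open>Stanley depth\<close>

text \<open>Each exponent in \<open>E\<close> belongs to exactly one cone, so each coefficient of a
  sum comes from a single summand. This yields both the existence and the uniqueness of the
  components.\<close>

lemma stanley_decomp_of_partition: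
  fixes E :: "('x \<Rightarrow>\<^sub>0 nat) set"
  assumes "cone_partition (set L) E" "distinct L"
  shows "stanley_decomp (polys_on E :: ('x, 'k::field) mpoly set)
    (map (\<lambda>(a, Z). (Poly_Mapping.single a 1, Z)) L)"
proof -
  define C where "C i = (case L ! i of (a, Z) \<Rightarrow> cone a Z)" for i
  have E: "E = (\<Union>i<length L. C i)"
    using assms(1) unfolding cone_partition_def C_def by (force simp: set_conv_nth)
  \<comment> \<open>Distinctness of \<open>L\<close> turns different positions into different pairs,
    to which disjointness of the family applies.\<close>
  have disj: "C i \<inter> C j = {}" if "i < length L" "j < length L" "i \<noteq> j" for i j
    using assms that unfolding cone_partition_def disjoint_family_on_def C_def
    by (metis nth_eq_iff_index_eq nth_mem)
  have space: "stanley_space (map (\<lambda>(a, Z). (Poly_Mapping.single a 1, Z)) L ! i) =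
      (polys_on (C i) :: ('x, 'k) mpoly set)" if "i < length L" for i
    using that by (simp add: C_def stanley_space_single split: prod.split)
  have lookup_summand: "lookup (\<Sum>i<length L. f i) t = lookup (f j) t"
    if f: "\<forall>i<length L. f i \<in> polys_on (C i)" and j: "j < length L" "t \<in> C j"
    for f :: "nat \<Rightarrow> ('x, 'k) mpoly" and j t
  proof -
    have "lookup (f i) t = 0" if "i < length L" "i \<noteq> j" for i
      using disj[OF that(1) j(1) that(2)] f that(1) j(2)
      by (auto simp: polys_on_def subset_iff in_keys_iff)
    then have "(\<Sum>i<length L. lookup (f i) t) = (\<Sum>i\<in>{j}. lookup (f i) t)"
      using j(1) by (intro sum.mono_neutral_right) auto
    then show ?thesis by (simp add: lookup_sum)
  qed
  have "direct_sum_decomp {..<length L} (\<lambda>i. polys_on (C i)) (polys_on E :: ('x, 'k) mpoly set)"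
    unfolding direct_sum_decomp_def
  proof (intro conjI allI impI equalityI subsetI ballI)
    fix p :: "('x, 'k) mpoly" assume p: "p \<in> polys_on E"
    let ?f = "\<lambda>i. restrict_poly (C i) p"
    have f: "\<forall>i<length L. ?f i \<in> polys_on (C i)"
      by (simp add: restrict_poly_in_polys_on)
    have "p = (\<Sum>i<length L. ?f i)"
    proof (rule poly_mapping_eqI)
      fix t
      show "lookup p t = lookup (\<Sum>i<length L. ?f i) t"
      proof (cases "t \<in> E")
        case True
        then obtain j where "j < length L" "t \<in> C j" using E by blast
        then show ?thesis
          using lookup_summand[OF f] by (simp add: lookup_restrict_poly)
      next
        case False
        then have "lookup p t = 0"
          using p by (auto simp: polys_on_def in_keys_iff)
        then show ?thesis by (simp add: lookup_sum lookup_restrict_poly cong: if_cong)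
      qed
    qed
    then show "p \<in> {\<Sum>i<length L. f i | f. \<forall>i\<in>{..<length L}. f i \<in> polys_on (C i)}"
      using f by blast
  next
    fix p :: "('x, 'k) mpoly"
    assume "p \<in> {\<Sum>i<length L. f i | f. \<forall>i\<in>{..<length L}. f i \<in> polys_on (C i)}"
    then obtain f where f: "p = (\<Sum>i<length L. f i)" "\<forall>i\<in>{..<length L}. f i \<in> polys_on (C i)"
      by blast
    then show "p \<in> polys_on E"
      using order_trans[OF keys_sum UN_mono] unfolding E polys_on_def
      by (metis (lifting) mem_Collect_eq order_refl)
  next
    fix f :: "nat \<Rightarrow> ('x, 'k) mpoly" and j
    assume "(\<forall>i\<in>{..<length L}. f i \<in> polys_on (C i)) \<and> (\<Sum>i<length L. f i) = 0"
      and j: "j \<in> {..<length L}"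
    then have f: "\<forall>i<length L. f i \<in> polys_on (C i)" and 0: "(\<Sum>i<length L. f i) = 0"
      by auto
    show "f j = 0"
    proof (rule poly_mapping_eqI)
      fix t
      \<comment> \<open>Inside \<open>C j\<close> the coefficient is that of the whole sum, which is
        zero; outside it vanishes by the support condition.\<close>
      show "lookup (f j) t = lookup 0 t"
        using lookup_summand[OF f, of j t] polys_on_lookup[of "f j" "C j" t] f j 0
        by (cases "t \<in> C j") auto
    qed
  qed
  then have "direct_sum_decomp {..<length L}
      (\<lambda>i. stanley_space (map (\<lambda>(a, Z). (Poly_Mapping.single a 1, Z)) L ! i))
      (polys_on E :: ('x, 'k) mpoly set)"
    unfolding direct_sum_decomp_def using space by (simp cong: sum.cong)
  then show ?thesis
    unfolding stanley_decomp_def by (auto simp: monomials_def)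
qed

lemma partitionable_imp_decomp_sdepth:
  fixes E :: "('x \<Rightarrow>\<^sub>0 nat) set"
  assumes "partitionable m E" "E \<noteq> {}"
  obtains D where "stanley_decomp (polys_on E :: ('x, 'k::field) mpoly set) D" "m \<le> decomp_sdepth D"
proof -
  obtain P where P: "cone_partition P E" "\<forall>(a, Z)\<in>P. m \<le> card Z"
    using assms(1) unfolding partitionable_def by blast
  obtain L where L: "set L = P" "distinct L"
    using P(1) finite_distinct_list unfolding cone_partition_def by blast
  let ?D = "map (\<lambda>(a, Z). (Poly_Mapping.single a 1 :: ('x, 'k) mpoly, Z)) L"
  \<comment> \<open>The minimum in \<open>decomp_sdepth\<close> is then taken over a nonempty set,
    so a lower bound for the members bounds it.\<close>
  have "L \<noteq> []"
    using P(1) L(1) assms(2) unfolding cone_partition_def by auto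
  then have "m \<le> decomp_sdepth ?D"
    unfolding decomp_sdepth_def using P(2) L(1) by (subst Min_ge_iff) auto
  then show thesis
    using that[OF stanley_decomp_of_partition] P(1) L by blast
qed

section \<open>Upper bound: decompositions with all variables free\<close>

lemma full_stanley_decomp_principal:
  fixes D :: "(('x, 'k::field) mpoly \<times> 'x set) list"
  assumes D: "stanley_decomp I D" and full: "\<forall>(u, Z)\<in>set D. Z = UNIV" and "I \<noteq> {0}"
  obtains a where "I = polys_on (upset a)"
proof -
  let ?V = "\<lambda>i. stanley_space (D ! i)"
  have sum: "I = {\<Sum>i<length D. f i | f. \<forall>i\<in>{..<length D}. f i \<in> ?V i}"
    and indep: "\<And>f. (\<forall>i<length D. f i \<in> ?V i) \<Longrightarrow> (\<Sum>i<length D. f i) = 0 \<Longrightarrow>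
      (\<forall>i<length D. f i = 0)"
    using D unfolding stanley_decomp_def direct_sum_decomp_def by auto
  have "\<exists>a. D ! i = (Poly_Mapping.single a 1, UNIV)" if "i < length D" for i
    using D full nth_mem[OF that] unfolding stanley_decomp_def monomials_def
    by (cases "D ! i") fastforce
  then obtain a where "\<And>i. i < length D \<Longrightarrow> D ! i = (Poly_Mapping.single (a i) 1, UNIV)"
    by metis
  then have V: "?V i = polys_on (upset (a i))" if "i < length D" for i
    using that by (simp add: stanley_space_single)
  \<comment> \<open>The empty sum would make \<open>I\<close> the zero ideal.\<close>
  have "length D \<noteq> 0"
    using sum \<open>I \<noteq> {0}\<close> by auto
  moreover have "\<not> 2 \<le> length D"
  proof
    assume len: "2 \<le> length D"
    \<comment> \<open>The product of the first two generating monomials lies in both spaces. Taking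
      \<open>p\<close> in one and \<open>- p\<close> in the other gives a nontrivial
      relation.\<close>
    define p :: "('x, 'k) mpoly" where "p = Poly_Mapping.single (a 0 + a 1) 1"
    define f where "f i = (if i = 0 then p else if i = 1 then - p else 0)" for i :: nat
    have "f i \<in> ?V i" if "i < length D" for i
      unfolding V[OF that] f_def p_def by (simp add: polys_on_def)
    moreover have "(\<Sum>i<length D. f i) = (\<Sum>i\<in>{0, 1}. f i)"
      using len by (intro sum.mono_neutral_right) (auto simp: f_def)
    then have "(\<Sum>i<length D. f i) = 0"
      by (simp add: f_def)
    ultimately have "f 0 = 0"
      using indep len by fastforce
    then have "lookup p (a 0 + a 1) = 0" by (simp add: f_def)
    then show False by (simp add: p_def)
  qed
  ultimately have "length D = 1" by linarith
  then have "I = {f 0 | f :: nat \<Rightarrow> _. f 0 \<in> ?V 0}"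
    using sum by (simp add: lessThan_Suc)
  also have "\<dots> = ?V 0"
    by (auto intro: exI[of _ "\<lambda>_::nat. _"])
  finally show thesis
    using that V \<open>length D = 1\<close> by simp
qed

lemma decomp_sdepth_less:
  fixes I :: "('x::finite, 'k::field) mpoly set"
  assumes D: "stanley_decomp I D" and "I \<noteq> {0}" "num_gens I \<noteq> 1"
  shows "decomp_sdepth D < CARD('x)"
proof (rule ccontr)
  assume *: "\<not> decomp_sdepth D < CARD('x)"
  \<comment> \<open>For an empty \<open>D\<close> this is vacuous; that case is excluded through
    \<open>I \<noteq> {0}\<close> by \<open>full_stanley_decomp_principal\<close>.\<close>
  have "Z = UNIV" if "(u, Z) \<in> set D" for u Z
  proof -
    have "decomp_sdepth D \<le> card Z"
      unfolding decomp_sdepth_def using that by (intro Min_le) force+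
    then have "card Z = CARD('x)"
      using * card_mono[of UNIV Z] by simp
    then show ?thesis
      by (metis card_subset_eq finite subset_UNIV)
  qed
  then obtain a where "I = polys_on (upset a)"
    using full_stanley_decomp_principal[OF D] \<open>I \<noteq> {0}\<close> by blast
  then show False
    using \<open>num_gens I \<noteq> 1\<close> num_gens_principal by blast
qed

text \<open>The partition of a union of three orthants gives the lower bound. The upper bound holds
  because \<open>I\<close> is not principal.\<close>

lemma sdepth_three_gens:
  fixes I :: "('x::finite, 'k::field) mpoly set"
  assumes "monomial_ideal I" "num_gens I = 3"
  shows "sdepth I = CARD('x) - 1"
proof -
  obtain T where T: "I = polys_on (\<Union>(upset ` T))" "card T = 3"
    using monomial_ideal_min_exps[OF assms(1)] assms(2) by metis
  obtain a b c where abc: "T = {a, b, c}"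
    using T(2) by (auto simp: card_3_iff)
  have I: "I = polys_on (upset a \<union> upset b \<union> upset c)"
    unfolding T(1) abc by (simp add: Un_assoc)
  have "Poly_Mapping.single a 1 \<in> I"
    unfolding I by simp
  moreover have "Poly_Mapping.single a (1::'k) \<noteq> 0"
    by (metis keys_single keys_zero insert_not_empty zero_neq_one)
  ultimately have "I \<noteq> {0}" by auto
  let ?S = "{decomp_sdepth D | D. stanley_decomp I D}"
  have upper: "d \<le> CARD('x) - 1" if "d \<in> ?S" for d
    using that decomp_sdepth_less[OF _ \<open>I \<noteq> {0}\<close>] assms(2) by fastforce
  \<comment> \<open>Finiteness gives \<open>Max\<close> its meaning as the largest attained
    depth.\<close>
  then have fin: "finite ?S"
    by (meson finite_nat_set_iff_bounded_le)
  have "upset a \<union> upset b \<union> upset c \<noteq> {}"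
    using apex_in_cone by blast
  then obtain D where "stanley_decomp I D" "CARD('x) - 1 \<le> decomp_sdepth D"
    using partitionable_imp_decomp_sdepth[OF partitionable_three] unfolding I by blast
  moreover from this have "decomp_sdepth D \<le> CARD('x) - 1"
    by (intro upper) blast
  ultimately have "CARD('x) - 1 \<in> ?S"
    by (auto intro!: exI[of _ D])
  then show ?thesis
    unfolding sdepth_def using fin upper by (intro Max_eqI) blast+
qed

theorem theorem2p4:
  fixes I :: "(3, 'k::field) mpoly set"
  assumes "monomial_ideal I"
    and "num_gens I = 3"
    and "num_supp_reduced I = 3"
  shows "sdepth I = 2"
  using sdepth_three_gens[OF assms(1,2)] by simp

end
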